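(* Let $N=\{1,\dots,n\}$ be a finite set of agents, $O=\{o_1,\dots,o_n\}$ a set of $n$ objects with $o_i$ the endowment of agent $i$, $\mathcal{P}$ the set of all strict linear orders on $O$, and $\mathcal{X}$ the set of allocations (bijections $N\to O$). Suppose $\mathcal{D}\subseteq\mathcal{P}$ does not satisfy the top-two condition. Suppose further that there exists a subset $O'\subseteq O$ such that: (i) $\mathcal{D}$ does not satisfy the top-two condition within $O'$; (ii) $|O'|\leq 4$; (iii) for every $o\in O\setminus O'$, $o\in r_1(\mathcal{D},O'\cup\{o\})$. Then there exists a rule $\varphi:\mathcal{D}^N\to\mathcal{X}$, distinct from the TTC rule on $\mathcal{D}$, that is individually rational, Pareto efficient, and strategyproof.
   Context: Setting. $N=\{1,\dots,n\}$ is a finite set of agents and $O=\{o_1,\dots,o_n\}$ a set of $n$ distinct objects; $o_i$ is agent $i$'s endowment. $\mathcal{P}$ is the set of all strict linear orders over $O$; a domain is a subset $\mathcal{D}\subseteq\mathcal{P}$ (all inclusions are weak). A preference profile is $P=(P_i)_{i\in N}\in\mathcal{D}^N$. For $P_0\in\mathcal{D}$, $a\mathrel{P_0}b$ means $a$ is strictly preferred to $b$, and $a\mathrel{R_0}b$ means $a\mathrel{P_0}b$ or $a=b$. $(P_i',P_{-i})$ denotes the profile $P$ with agent $i$'s preference replaced by $P_i'$. An allocation is a bijection $x:N\to O$, with $x_i=x(i)$; $\mathcal{X}$ is the set of allocations. A rule is a function $\varphi:\mathcal{D}^N\to\mathcal{X}$, and $\varphi_i(P)$ is the object assigned to $i$.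 Ranks. For $O'\subseteq O$ and $P_0\in\mathcal{D}$, $r_k(P_0,O')$ is the object of $O'$ ranked $k$-th by $P_0$ restricted to $O'$. $r_1(\mathcal{D},O')=\{r_1(P_0,O'):P_0\in\mathcal{D}\}$. Top-two condition. $\mathcal{D}$ satisfies the top-two condition within $O'\subseteq O$ if for any distinct $a,b\in r_1(\mathcal{D},O')$ there is $P_0\in\mathcal{D}$ with $a=r_1(P_0,O')$ and $b=r_2(P_0,O')$. $\mathcal{D}$ satisfies the top-two condition if it satisfies it within every $O'\subseteq O$. Axioms. A rule $\varphi$ is individually rational if for all $P\in\mathcal{D}^N$ and $i\in N$, $\varphi_i(P)\mathrel{R_i}o_i$. It is Pareto efficient if for each $P\in\mathcal{D}^N$ there is no $y\in\mathcal{X}$ with $y_i\mathrel{R_i}\varphi_i(P)$ for all $i\in N$ and $y_j\mathrel{P_j}\varphi_j(P)$ for some $j\in N$. It is strategyproof if for all $P\in\mathcal{D}^N$, there are no $i\in N$ and $P_i'\in\mathcal{D}$ with $\varphi_i(P_i',P_{-i})\mathrel{P_i}\varphi_i(P)$. TTC. For $P\in\mathcal{P}^N$, the allocation $TTC(P)$ is produced by the Top Trading Cycles algorithm: (1) each agent points to the agent who owns their most-preferred object (among those remaining); (2) the resulting directed graph has at least one cycle (self-loops count as cycles); all agents belonging to cycles are assigned the objects they point to and leave, with those objects; (3) repeat with the remaining agents and objects until none remain. The TTC rule on $\mathcal{D}$ is $P\mapsto TTC(P)$ on $\mathcal{D}^N$. *)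

theory Defs
  imports "HOL-Library.FuncSet"
begin

section \<open>Preferences and ranks\<close>

text \<open>A pair \<open>(a, b)\<close> in a preference means that \<open>a\<close> is strictly preferred to \<open>b\<close>. A preference is
  a strict linear order on the set of objects, and relates no elements outside that set.\<close>

definition prefs :: "'o set \<Rightarrow> 'o rel set" where
  "prefs Obj = {P\<^sub>0. P\<^sub>0 \<subseteq> Obj \<times> Obj \<and> strict_linear_order_on Obj P\<^sub>0}"

definition weakly_pref :: "'o rel \<Rightarrow> 'o \<Rightarrow> 'o \<Rightarrow> bool" where
  "weakly_pref P\<^sub>0 a b \<longleftrightarrow> (a, b) \<in> P\<^sub>0 \<or> a = b"

text \<open>\<open>rank k P\<^sub>0 S\<close> is the \<open>k\<close>-th ranked object of \<open>S\<close>, i.e. the one to which exactly \<open>k - 1\<close> objects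
  of \<open>S\<close> are preferred. It is meaningful only for \<open>1 \<le> k \<le> card S\<close>.\<close>

definition rank :: "nat \<Rightarrow> 'o rel \<Rightarrow> 'o set \<Rightarrow> 'o" where
  "rank k P\<^sub>0 S = (THE a. a \<in> S \<and> card {b \<in> S. (b, a) \<in> P\<^sub>0} + 1 = k)"

definition tops :: "'o rel set \<Rightarrow> 'o set \<Rightarrow> 'o set" where
  "tops D S = (\<lambda>P\<^sub>0. rank 1 P\<^sub>0 S) ` D"

definition top_two_within :: "'o rel set \<Rightarrow> 'o set \<Rightarrow> bool" where
  "top_two_within D S \<longleftrightarrow>
     (\<forall>a \<in> tops D S. \<forall>b \<in> tops D S. a \<noteq> b \<longrightarrow>
        (\<exists>P\<^sub>0 \<in> D. a = rank 1 P\<^sub>0 S \<and> b = rank 2 P\<^sub>0 S))"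

definition top_two :: "'o set \<Rightarrow> 'o rel set \<Rightarrow> bool" where
  "top_two Obj D \<longleftrightarrow> (\<forall>S \<subseteq> Obj. top_two_within D S)"


section \<open>Allocations, rules and axioms\<close>

text \<open>Profiles, allocations and rules are extensional functions, so that equality of functions is
  agreement on the intended domain.\<close>

definition profiles :: "'i set \<Rightarrow> 'o rel set \<Rightarrow> ('i \<Rightarrow> 'o rel) set" where
  "profiles N D = (N \<rightarrow>\<^sub>E D)"

definition allocations :: "'i set \<Rightarrow> 'o set \<Rightarrow> ('i \<Rightarrow> 'o) set" where
  "allocations N Obj = {x \<in> N \<rightarrow>\<^sub>E Obj. bij_betw x N Obj}"

definition rules ::
  "'i set \<Rightarrow> 'o set \<Rightarrow> 'o rel set \<Rightarrow> (('i \<Rightarrow> 'o rel) \<Rightarrow> 'i \<Rightarrow> 'o) set" where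
  "rules N Obj D = (profiles N D \<rightarrow>\<^sub>E allocations N Obj)"

definition individually_rational ::
  "'i set \<Rightarrow> ('i \<Rightarrow> 'o) \<Rightarrow> 'o rel set \<Rightarrow> (('i \<Rightarrow> 'o rel) \<Rightarrow> 'i \<Rightarrow> 'o) \<Rightarrow> bool" where
  "individually_rational N e D \<phi> \<longleftrightarrow>
     (\<forall>P \<in> profiles N D. \<forall>i \<in> N. weakly_pref (P i) (\<phi> P i) (e i))"

definition pareto_efficient ::
  "'i set \<Rightarrow> 'o set \<Rightarrow> 'o rel set \<Rightarrow> (('i \<Rightarrow> 'o rel) \<Rightarrow> 'i \<Rightarrow> 'o) \<Rightarrow> bool" where
  "pareto_efficient N Obj D \<phi> \<longleftrightarrow>
     (\<forall>P \<in> profiles N D. \<not> (\<exists>y \<in> allocations N Obj.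
        (\<forall>i \<in> N. weakly_pref (P i) (y i) (\<phi> P i)) \<and>
        (\<exists>j \<in> N. (y j, \<phi> P j) \<in> P j)))"

definition strategyproof ::
  "'i set \<Rightarrow> 'o rel set \<Rightarrow> (('i \<Rightarrow> 'o rel) \<Rightarrow> 'i \<Rightarrow> 'o) \<Rightarrow> bool" where
  "strategyproof N D \<phi> \<longleftrightarrow>
     (\<forall>P \<in> profiles N D. \<not> (\<exists>i \<in> N. \<exists>P' \<in> D. (\<phi> (P(i := P')) i, \<phi> P i) \<in> P i))"


section \<open>Top Trading Cycles\<close>

text \<open>\<open>e i\<close> is the endowment of agent \<open>i\<close>. When the agents in \<open>M\<close> remain, the remaining objects are
  \<open>e ` M\<close>, since whoever leaves owns an object taken away along the same cycle.\<close>

definition ttc_points :: "('i \<Rightarrow> 'o) \<Rightarrow> ('i \<Rightarrow> 'o rel) \<Rightarrow> 'i set \<Rightarrow> 'i rel" where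
  "ttc_points e P M = {(i, j). i \<in> M \<and> j \<in> M \<and> e j = rank 1 (P i) (e ` M)}"

definition ttc_leaving :: "('i \<Rightarrow> 'o) \<Rightarrow> ('i \<Rightarrow> 'o rel) \<Rightarrow> 'i set \<Rightarrow> 'i set" where
  "ttc_leaving e P M = {i \<in> M. (i, i) \<in> (ttc_points e P M)\<^sup>+}"

primrec ttc_remaining :: "'i set \<Rightarrow> ('i \<Rightarrow> 'o) \<Rightarrow> ('i \<Rightarrow> 'o rel) \<Rightarrow> nat \<Rightarrow> 'i set" where
  "ttc_remaining N e P 0 = N"
| "ttc_remaining N e P (Suc t) =
     ttc_remaining N e P t - ttc_leaving e P (ttc_remaining N e P t)"

definition ttc_round :: "'i set \<Rightarrow> ('i \<Rightarrow> 'o) \<Rightarrow> ('i \<Rightarrow> 'o rel) \<Rightarrow> 'i \<Rightarrow> nat" where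
  "ttc_round N e P i = (LEAST t. i \<in> ttc_leaving e P (ttc_remaining N e P t))"

definition ttc :: "'i set \<Rightarrow> ('i \<Rightarrow> 'o) \<Rightarrow> ('i \<Rightarrow> 'o rel) \<Rightarrow> 'i \<Rightarrow> 'o" where
  "ttc N e P = (\<lambda>i \<in> N. rank 1 (P i) (e ` ttc_remaining N e P (ttc_round N e P i)))"

definition ttc_rule ::
  "'i set \<Rightarrow> ('i \<Rightarrow> 'o) \<Rightarrow> 'o rel set \<Rightarrow> ('i \<Rightarrow> 'o rel) \<Rightarrow> 'i \<Rightarrow> 'o" where
  "ttc_rule N e D = (\<lambda>P \<in> profiles N D. ttc N e P)"


section \<open>The TTC rule is a rule\<close>

lemma rank_1_eqI:
  assumes P: "P\<^sub>0 \<in> prefs Obj" and S: "S \<subseteq> Obj" "finite S"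
    and a: "a \<in> S" "\<And>b. b \<in> S \<Longrightarrow> (b, a) \<notin> P\<^sub>0"
  shows "rank 1 P\<^sub>0 S = a"
  unfolding rank_def
proof (rule the_equality)
  show "a \<in> S \<and> card {b \<in> S. (b, a) \<in> P\<^sub>0} + 1 = 1"
  proof -
    have "{b \<in> S. (b, a) \<in> P\<^sub>0} = {}" using a by blast
    then have "card {b \<in> S. (b, a) \<in> P\<^sub>0} = 0" by (simp only: card.empty)
    then show ?thesis using a by simp
  qed
next
  fix c assume c: "c \<in> S \<and> card {b \<in> S. (b, c) \<in> P\<^sub>0} + 1 = 1"
  then have "{b \<in> S. (b, c) \<in> P\<^sub>0} = {}"
    using S by simp
  then have "(a, c) \<notin> P\<^sub>0" using a by blast
  moreover have "(c, a) \<notin> P\<^sub>0" using a c by blast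
  ultimately show "c = a"
    using P S a c unfolding prefs_def strict_linear_order_on_def total_on_def by blast
qed

lemma rank_1_in:
  assumes P: "P\<^sub>0 \<in> prefs Obj" and S: "S \<subseteq> Obj" "finite S" "S \<noteq> {}"
  shows "rank 1 P\<^sub>0 S \<in> S"
proof -
  let ?r = "P\<^sub>0 \<inter> S \<times> S"
  have t: "trans P\<^sub>0" and i: "irrefl P\<^sub>0"
    using P by (auto simp: prefs_def strict_linear_order_on_def)
  have "trans ?r" using t by (auto simp: trans_def)
  then have "acyclic ?r"
    using i by (simp add: acyclic_irrefl trancl_id irrefl_def)
  then have "wf ?r"
    using S by (intro finite_acyclic_wf) auto
  then obtain a where "a \<in> S" "\<And>b. (b, a) \<in> ?r \<Longrightarrow> b \<notin> S"
    using S(3) by (metis wf_eq_minimal ex_in_conv)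
  then show ?thesis
    using rank_1_eqI[OF P S(1,2)] by blast
qed

lemma ttc_leaving_nonempty:
  assumes inj: "inj_on e N" and eN: "e ` N = Obj"
    and P: "\<And>i. i \<in> N \<Longrightarrow> P i \<in> prefs Obj"
    and M: "M \<subseteq> N" "finite M" "M \<noteq> {}"
  shows "ttc_leaving e P M \<noteq> {}"
proof
  assume em: "ttc_leaving e P M = {}"
  let ?r = "ttc_points e P M"
  have rsub: "?r \<subseteq> M \<times> M" by (auto simp: ttc_points_def)
  then have "?r\<^sup>+ \<subseteq> M \<times> M" by (rule trancl_subset_Sigma)
  then have "acyclic ?r"
    using em by (auto simp: ttc_leaving_def acyclic_def)
  moreover have "finite ?r" using rsub M by (meson finite_SigmaI finite_subset)
  ultimately have wf: "wf (?r\<inverse>)" by (simp add: finite_acyclic_wf_converse)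
  obtain i where i: "i \<in> M" "\<And>j. (j, i) \<in> ?r\<inverse> \<Longrightarrow> j \<notin> M"
    using wfE_min'[OF wf M(3)] by blast
  have "P i \<in> prefs Obj" "e ` M \<subseteq> Obj" using i(1) M P eN by auto
  then have "rank 1 (P i) (e ` M) \<in> e ` M"
    using M by (intro rank_1_in) auto
  then obtain j where "j \<in> M" "e j = rank 1 (P i) (e ` M)" by force
  then have "(j, i) \<in> ?r\<inverse>" using i(1) by (simp add: ttc_points_def)
  then show False using i(2) \<open>j \<in> M\<close> by blast
qed

lemma ttc_remaining_subset: "ttc_remaining N e P t \<subseteq> N"
  by (induction t) auto

lemma ttc_remaining_antimono: "s \<le> t \<Longrightarrow> ttc_remaining N e P t \<subseteq> ttc_remaining N e P s"
  by (rule lift_Suc_antimono_le) auto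

lemma ttc_remaining_card:
  assumes "inj_on e N" "e ` N = Obj" "finite N"
    and "\<And>i. i \<in> N \<Longrightarrow> P i \<in> prefs Obj"
  shows "card (ttc_remaining N e P t) \<le> card N - t"
proof (induction t)
  case (Suc t)
  let ?M = "ttc_remaining N e P t"
  have M: "?M \<subseteq> N" "finite ?M"
    using ttc_remaining_subset[of N e P t] assms(3) by (simp_all add: finite_subset)
  show ?case
  proof (cases "?M = {}")
    case False
    have ne: "ttc_leaving e P ?M \<noteq> {}"
      using ttc_leaving_nonempty[of e N Obj P, OF assms(1,2,4) M False] .
    moreover have "ttc_leaving e P ?M \<subseteq> ?M" by (auto simp: ttc_leaving_def)
    ultimately have "card (?M - ttc_leaving e P ?M) < card ?M"
      using M by (intro psubset_card_mono) auto
    then show ?thesis using Suc by simp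
  qed simp
qed simp

lemma ttc_round_leaves:
  assumes "inj_on e N" "e ` N = Obj" "finite N"
    and "\<And>i. i \<in> N \<Longrightarrow> P i \<in> prefs Obj" and i: "i \<in> N"
  shows "i \<in> ttc_leaving e P (ttc_remaining N e P (ttc_round N e P i))"
proof -
  have "card (ttc_remaining N e P (card N)) = 0"
    using ttc_remaining_card[of e N Obj P "card N", OF assms(1-4)] by simp
  then have e: "i \<notin> ttc_remaining N e P (card N)"
    using finite_subset[OF ttc_remaining_subset[of N e P "card N"] assms(3)] by simp
  have "\<exists>t. i \<in> ttc_leaving e P (ttc_remaining N e P t)"
  proof (rule ccontr)
    assume a: "\<nexists>t. i \<in> ttc_leaving e P (ttc_remaining N e P t)"
    have "i \<in> ttc_remaining N e P t" for t using a i by (induction t) auto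
    then show False using e by blast
  qed
  then show ?thesis unfolding ttc_round_def by (rule LeastI_ex)
qed

text \<open>Each agent leaves with the endowment of an agent on the same cycle.\<close>

lemma ttc_leaving_successor:
  assumes "i \<in> ttc_leaving e P M"
  obtains j where "j \<in> ttc_leaving e P M" "(i, j) \<in> ttc_points e P M"
    "e j = rank 1 (P i) (e ` M)"
proof -
  from assms have "(i, i) \<in> (ttc_points e P M)\<^sup>+" by (simp add: ttc_leaving_def)
  then obtain j where j: "(i, j) \<in> ttc_points e P M" "(j, i) \<in> (ttc_points e P M)\<^sup>*"
    by (meson tranclD)
  then have "(j, j) \<in> (ttc_points e P M)\<^sup>+" by (meson rtrancl_into_trancl1)
  then show ?thesis
    using j(1) by (intro that[of j]) (simp_all add: ttc_leaving_def ttc_points_def)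
qed

lemma ttc_leaving_inj:
  assumes inj: "inj_on e M"
    and i: "i \<in> ttc_leaving e P M" and i': "i' \<in> ttc_leaving e P M"
    and j: "(i, j) \<in> ttc_points e P M" "(i', j) \<in> ttc_points e P M"
  shows "i = i'"
proof -
  let ?r = "ttc_points e P M"
  have sv: "single_valued ?r"
    using inj unfolding single_valued_def ttc_points_def inj_on_def by auto
  have p: "(j, i) \<in> ?r\<^sup>*" "(j, i') \<in> ?r\<^sup>*"
    using i i' j sv unfolding ttc_leaving_def
    by (blast dest: tranclD single_valuedD)+
  have reach: "(j, x) \<in> ?r\<^sup>* \<Longrightarrow> \<exists>m. x = ((\<lambda>y. THE z. (y, z) \<in> ?r) ^^ m) j" for x
  proof (induction rule: rtrancl_induct)
    case base show ?case by (rule exI[of _ 0]) simp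
  next
    case (step y z)
    then obtain m where "y = ((\<lambda>y. THE z. (y, z) \<in> ?r) ^^ m) j" by blast
    moreover have "(THE z. (y, z) \<in> ?r) = z"
      using sv step(2) unfolding single_valued_def by blast
    ultimately show ?case by (intro exI[of _ "Suc m"]) simp
  qed
  let ?f = "\<lambda>y. THE z. (y, z) \<in> ?r"
  have f: "?f i = j" "?f i' = j"
    using sv j unfolding single_valued_def by blast+
  obtain m where m: "i = (?f ^^ m) j" using reach p by blast
  obtain m' where m': "i' = (?f ^^ m') j" using reach p by blast
  have c: "(?f ^^ Suc m) j = j" "(?f ^^ Suc m') j = j"
    using f m m' by simp_all
  have per: "(?f ^^ (k * Suc m)) j = j" "(?f ^^ (k * Suc m')) j = j" for k
    by (induction k) (simp_all only: mult_Suc funpow_add o_apply mult_0 funpow_0 c)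
  define K where "K = m + m' * Suc m"
  have "(?f ^^ K) j = i"
    using per(1)[of m'] m unfolding K_def by (simp only: funpow_add o_apply)
  moreover have "K = m' + m * Suc m'" unfolding K_def by (simp add: algebra_simps)
  then have "(?f ^^ K) j = i'"
    using per(2)[of m] m' by (simp only: funpow_add o_apply)
  ultimately show ?thesis by simp
qed

lemma ttc_in_allocations:
  assumes e: "bij_betw e N Obj" and N: "finite N"
    and P: "\<And>i. i \<in> N \<Longrightarrow> P i \<in> prefs Obj"
  shows "ttc N e P \<in> allocations N Obj"
proof -
  have inj: "inj_on e N" and eN: "e ` N = Obj" using e by (auto simp: bij_betw_def)
  let ?R = "ttc_remaining N e P" and ?t = "ttc_round N e P"
  have leaves: "i \<in> ttc_leaving e P (?R (?t i))" if "i \<in> N" for i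
    by (rule ttc_round_leaves[OF inj eN N]) (use P that in auto)
  have "\<exists>j. j \<in> ttc_leaving e P (?R (?t i)) \<and> (i, j) \<in> ttc_points e P (?R (?t i))
      \<and> e j = ttc N e P i" if "i \<in> N" for i
  proof -
    have "ttc N e P i = rank 1 (P i) (e ` ?R (?t i))" using that by (simp add: ttc_def)
    then show ?thesis using ttc_leaving_successor[OF leaves[OF that]] by metis
  qed
  then obtain s where s: "\<And>i. i \<in> N \<Longrightarrow> s i \<in> ttc_leaving e P (?R (?t i))"
    "\<And>i. i \<in> N \<Longrightarrow> (i, s i) \<in> ttc_points e P (?R (?t i))"
    "\<And>i. i \<in> N \<Longrightarrow> e (s i) = ttc N e P i" by metis
  have sN: "s i \<in> N" if "i \<in> N" for i
    using s(1)[OF that] ttc_remaining_subset[of N e P] by (auto simp: ttc_leaving_def)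
  have disj: "u = t" if "j \<in> ttc_leaving e P (?R t)" "j \<in> ttc_leaving e P (?R u)" for j t u
  proof -
    have "\<not> a < b" if "j \<in> ttc_leaving e P (?R a)" "j \<in> ttc_leaving e P (?R b)" for a b
    proof
      assume "a < b"
      then have "?R b \<subseteq> ?R (Suc a)" by (intro ttc_remaining_antimono) simp
      then show False using that by (auto simp: ttc_leaving_def)
    qed
    then show ?thesis using that by (metis nat_neq_iff)
  qed
  have "inj_on s N"
  proof (rule inj_onI)
    fix i i' assume i: "i \<in> N" "i' \<in> N" "s i = s i'"
    then have t: "?t i = ?t i'" using s(1) disj by metis
    show "i = i'"
    proof (rule ttc_leaving_inj)
      show "inj_on e (?R (?t i))" using inj ttc_remaining_subset by (rule inj_on_subset)
      show "i \<in> ttc_leaving e P (?R (?t i))" "i' \<in> ttc_leaving e P (?R (?t i))"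
        using leaves i t by metis+
      show "(i, s i) \<in> ttc_points e P (?R (?t i))" "(i', s i) \<in> ttc_points e P (?R (?t i))"
        using s(2) i t by metis+
    qed
  qed
  then have "bij_betw s N N"
    using sN N by (simp add: bij_betw_def endo_inj_surj image_subset_iff)
  then have "bij_betw (e \<circ> s) N Obj" using e by (rule bij_betw_trans)
  then have b: "bij_betw (ttc N e P) N Obj"
    by (rule bij_betw_cong[THEN iffD1, rotated]) (simp add: s(3))
  moreover have "ttc N e P \<in> extensional N" by (simp add: ttc_def)
  ultimately show ?thesis
    unfolding allocations_def PiE_def by (auto simp: bij_betw_def)
qed

lemma ttc_rule_in_rules:
  assumes "bij_betw e N Obj" "finite N" "D \<subseteq> prefs Obj"
  shows "ttc_rule N e D \<in> rules N Obj D"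
proof -
  have "ttc N e P \<in> allocations N Obj" if "P \<in> profiles N D" for P
    using that assms by (intro ttc_in_allocations) (auto simp: profiles_def)
  then show ?thesis by (simp add: ttc_rule_def rules_def)
qed

end

theory Submission
  imports Defs
begin

text \<open>
  TTC outcomes are competitive equilibria: price an object by the round in which it leaves, earlier
  rounds being dearer. Individual rationality, Pareto efficiency and strategyproofness of TTC follow
  by comparing and summing prices.

  Let \<open>a\<close> and \<open>b\<close> be the tops in \<open>S\<close> for which no preference ranks \<open>a\<close> first and \<open>b\<close> second. When
  the agents outside \<open>S\<close> trade among themselves, the owners of \<open>a\<close> and \<open>b\<close> want to swap, and the
  other objects of \<open>S\<close> all lead to \<open>a\<close> by pointing, the new rule still gives \<open>b\<close> to the owner of \<open>a\<close>
  but gives the owner of \<open>b\<close> only their second choice, which is not \<open>b\<close>; the pointing path from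
  that object to \<open>a\<close> is then executed. Whenever it applies, the owner of \<open>b\<close> cannot
  get \<open>a\<close> by any other report, while each remaining agent in \<open>S\<close> gets their best object other than
  \<open>b\<close>, or keeps their own object whatever they report, or faces the TTC outcome under all of their
  reports. This last trichotomy needs \<open>card S \<le> 4\<close>. If each outside agent prefers their own object to all of \<open>S\<close>, then the outside trades
  by itself, so there are profiles at which the new rule departs from TTC.
\<close>

section \<open>Best elements\<close>

lemma prefs_irrefl: "P\<^sub>0 \<in> prefs Obj \<Longrightarrow> (a, a) \<notin> P\<^sub>0"
  by (auto simp: prefs_def strict_linear_order_on_def irrefl_def)

lemma prefs_asym: "P\<^sub>0 \<in> prefs Obj \<Longrightarrow> (a, b) \<in> P\<^sub>0 \<Longrightarrow> (b, a) \<notin> P\<^sub>0"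
  unfolding prefs_def strict_linear_order_on_def irrefl_def trans_def by blast

lemma prefs_trans: "P\<^sub>0 \<in> prefs Obj \<Longrightarrow> (a, b) \<in> P\<^sub>0 \<Longrightarrow> (b, c) \<in> P\<^sub>0 \<Longrightarrow> (a, c) \<in> P\<^sub>0"
  unfolding prefs_def strict_linear_order_on_def trans_def by blast

lemma prefs_total:
  "P\<^sub>0 \<in> prefs Obj \<Longrightarrow> a \<in> Obj \<Longrightarrow> b \<in> Obj \<Longrightarrow> a \<noteq> b \<Longrightarrow> (a, b) \<in> P\<^sub>0 \<or> (b, a) \<in> P\<^sub>0"
  unfolding prefs_def strict_linear_order_on_def total_on_def by blast

lemma rank_1_preferred:
  assumes P: "P\<^sub>0 \<in> prefs Obj" and S: "S \<subseteq> Obj" "finite S"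
    and c: "c \<in> S" "c \<noteq> rank 1 P\<^sub>0 S"
  shows "(rank 1 P\<^sub>0 S, c) \<in> P\<^sub>0"
proof -
  have "asymp_on S (\<lambda>x y. (x, y) \<in> P\<^sub>0)"
    using prefs_asym[OF P] by (rule asymp_onI)
  moreover have "transp_on S (\<lambda>x y. (x, y) \<in> P\<^sub>0)"
    using prefs_trans[OF P] by (rule transp_onI)
  ultimately have "\<exists>m\<in>S. \<forall>x\<in>S. x \<noteq> m \<longrightarrow> (x, m) \<notin> P\<^sub>0"
    using S(2) c(1) by (intro Finite_Set.bex_min_element) auto
  then obtain m where m: "m \<in> S" "\<And>x. x \<in> S \<Longrightarrow> (x, m) \<notin> P\<^sub>0"
    using prefs_irrefl[OF P] by metis
  have "rank 1 P\<^sub>0 S = m"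
    by (rule rank_1_eqI[OF P S]) (use m in auto)
  then show ?thesis
    using prefs_total[OF P, of m c] m c S by auto
qed

text \<open>Lets the failure of the top-two condition be restated with best objects only: being
  second in \<open>S\<close> behind \<open>a\<close> is the same as being best in
  \<open>S - {a}\<close>. The locale assumption \<open>not_ab\<close> has that form.\<close>

lemma rank_2_eqI:
  assumes P: "P\<^sub>0 \<in> prefs Obj" and S: "S \<subseteq> Obj" "finite S"
    and a: "a \<in> S" "rank 1 P\<^sub>0 S = a" and b: "b \<in> S" "a \<noteq> b" "rank 1 P\<^sub>0 (S - {a}) = b"
  shows "rank 2 P\<^sub>0 S = b"
proof -
  have pa: "(a, c) \<in> P\<^sub>0" if "c \<in> S" "c \<noteq> a" for c
    using rank_1_preferred[OF P S that(1)] a that by auto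
  have pb: "(b, c) \<in> P\<^sub>0" if "c \<in> S" "c \<noteq> a" "c \<noteq> b" for c
    using rank_1_preferred[OF P, of "S - {a}" c] S b that by auto
  have "c = a" if "c \<in> S" "(c, b) \<in> P\<^sub>0" for c
    using that pb[of c] prefs_asym[OF P, of b c] prefs_irrefl[OF P, of b] by auto
  then have sb: "{c \<in> S. (c, b) \<in> P\<^sub>0} = {a}"
    using a(1) b(1,2) pa[of b] by blast
  show ?thesis
    unfolding rank_def
  proof (rule the_equality)
    show "b \<in> S \<and> card {c \<in> S. (c, b) \<in> P\<^sub>0} + 1 = 2"
      using b sb by simp
  next
    fix c assume c: "c \<in> S \<and> card {d \<in> S. (d, c) \<in> P\<^sub>0} + 1 = 2"
    show "c = b"
    proof (rule ccontr)
      assume "c \<noteq> b"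
      have "c \<noteq> a"
      proof
        assume "c = a"
        then have "{d \<in> S. (d, c) \<in> P\<^sub>0} = {}"
          using pa prefs_asym[OF P] prefs_irrefl[OF P] by blast
        then have "card {d \<in> S. (d, c) \<in> P\<^sub>0} = 0" by (simp only: card.empty)
        then show False using c by simp
      qed
      then have "{a, b} \<subseteq> {d \<in> S. (d, c) \<in> P\<^sub>0}"
        using pa pb c \<open>c \<noteq> b\<close> a b by auto
      then have "card {a, b} \<le> card {d \<in> S. (d, c) \<in> P\<^sub>0}"
        using S by (intro card_mono) auto
      then show False using c b by simp
    qed
  qed
qed


section \<open>Competitive equilibria\<close>

definition equilibrium ::
  "'i set \<Rightarrow> 'o set \<Rightarrow> ('i \<Rightarrow> 'o) \<Rightarrow> ('i \<Rightarrow> 'o rel) \<Rightarrow> ('i \<Rightarrow> 'o) \<Rightarrow> ('o \<Rightarrow> int) \<Rightarrow> bool" where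
  "equilibrium N Obj e P x p \<longleftrightarrow> x \<in> allocations N Obj \<and>
     (\<forall>i \<in> N. p (x i) = p (e i) \<and> (\<forall>c \<in> Obj. (c, x i) \<in> P i \<longrightarrow> p (e i) < p c))"

lemma allocations_bij: "x \<in> allocations N Obj \<Longrightarrow> bij_betw x N Obj"
  by (simp add: allocations_def)

lemma allocations_in: "x \<in> allocations N Obj \<Longrightarrow> i \<in> N \<Longrightarrow> x i \<in> Obj"
  by (auto simp: allocations_def)

lemma efficient_if_supported:
  fixes p :: "'o \<Rightarrow> int"
  assumes N: "finite N" and x: "x \<in> allocations N Obj" and y: "y \<in> allocations N Obj"
    and p: "\<And>i c. i \<in> N \<Longrightarrow> c \<in> Obj \<Longrightarrow> (c, x i) \<in> P i \<Longrightarrow> p (x i) < p c"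
    and w: "\<forall>i \<in> N. weakly_pref (P i) (y i) (x i)"
  shows "\<not> (\<exists>j \<in> N. (y j, x j) \<in> P j)"
proof
  assume s: "\<exists>j \<in> N. (y j, x j) \<in> P j"
  have "(\<Sum>i\<in>N. p (x i)) < (\<Sum>i\<in>N. p (y i))"
  proof (rule sum_strict_mono_ex1[OF N])
    show "\<forall>i\<in>N. p (x i) \<le> p (y i)"
      using w p allocations_in[OF y] unfolding weakly_pref_def by (metis order.refl order.strict_implies_order)
    show "\<exists>i\<in>N. p (x i) < p (y i)"
      using s p allocations_in[OF y] by blast
  qed
  then show False
    using sum.reindex_bij_betw[OF allocations_bij[OF x], of p]
      sum.reindex_bij_betw[OF allocations_bij[OF y], of p] by simp
qed

text \<open>What happens at prices from \<pi> upwards depends only on the preferences of agents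
  whose endowments cost at least \<pi>. Both strategyproofness and the independence of the outside
  market from reports inside \<open>S\<close> rest on this. The proof looks at the dearest price
  class with a disagreement.\<close>

lemma equilibrium_agree_above:
  assumes e: "bij_betw e N Obj" and N: "finite N"
    and x: "equilibrium N Obj e P x p" and y: "equilibrium N Obj e P' y q"
    and P: "\<And>i. i \<in> N \<Longrightarrow> P i \<in> prefs Obj"
    and agree: "\<And>i. i \<in> N \<Longrightarrow> \<pi> \<le> p (e i) \<Longrightarrow> P i = P' i"
    and i: "i \<in> N" "\<pi> \<le> p (e i)"
  shows "x i = y i"
proof (rule ccontr)
  assume ne: "x i \<noteq> y i"
  have xb: "bij_betw x N Obj" and yb: "bij_betw y N Obj"
    and xa: "x \<in> allocations N Obj" and ya: "y \<in> allocations N Obj"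
    using x y by (auto simp: equilibrium_def allocations_def)
  have px: "p (x j) = p (e j)" if "j \<in> N" for j using x that by (simp add: equilibrium_def)
  have bx: "p (e j) < p c" if "j \<in> N" "c \<in> Obj" "(c, x j) \<in> P j" for j c
    using x that by (simp add: equilibrium_def)
  have qy: "q (y j) = q (e j)" if "j \<in> N" for j using y that by (simp add: equilibrium_def)
  have qb: "q (e j) < q c" if "j \<in> N" "c \<in> Obj" "(c, y j) \<in> P' j" for j c
    using y that by (simp add: equilibrium_def)
  let ?B = "{j \<in> N. \<pi> \<le> p (e j) \<and> x j \<noteq> y j}"
  have "finite ?B" "?B \<noteq> {}" using N i ne by auto
  then obtain k where k: "k \<in> ?B" "\<And>j. j \<in> ?B \<Longrightarrow> p (e j) \<le> p (e k)"
    using Max_in[of "(p \<circ> e) ` ?B"] Max_ge[of "(p \<circ> e) ` ?B"] by fastforce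
  let ?K = "{j \<in> N. p (e j) = p (e k)}"
  have above: "y j = x j" if "j \<in> N" "p (e k) < p (e j)" for j
    using k(1) k(2)[of j] that by force
  \<comment> \<open>Objects dearer than the class already have the same holders under
    \<open>x\<close> and \<open>y\<close>. Hence \<open>y j\<close> is affordable at
    \<open>p\<close>, so \<open>j\<close> likes \<open>x j\<close> at least as much; read in the
    prices \<open>q\<close>, \<open>x j\<close> then costs at least \<open>q (e j)\<close>.\<close>
  have le: "p (y j) \<le> p (e k)" if j: "j \<in> ?K" for j
  proof (rule ccontr)
    assume a: "\<not> p (y j) \<le> p (e k)"
    obtain l where l: "l \<in> N" "x l = y j"
      using xb allocations_in[OF ya, of j] j by (metis (mono_tags, lifting) bij_betw_iff_bijections mem_Collect_eq)
    then have "y l = y j" using above[of l] px[of l] a by simp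
    then have "l = j" using yb l j by (auto simp: bij_betw_def inj_on_def)
    then show False using a px[of l] l j by simp
  qed
  have step: "x j = y j \<or> q (e j) < q (x j)" if j: "j \<in> ?K" for j
  proof -
    have "(y j, x j) \<notin> P j" using bx[of j "y j"] le[OF j] j allocations_in[OF ya] by force
    then have "x j = y j \<or> (x j, y j) \<in> P j"
      using prefs_total[OF P[of j], of "x j" "y j"] j allocations_in[OF xa] allocations_in[OF ya] by auto
    moreover have "P j = P' j" using agree[of j] j k(1) by auto
    ultimately show ?thesis using qb[of j "x j"] j allocations_in[OF xa] by auto
  qed
  \<comment> \<open>This is impossible, because \<open>e\<close> and \<open>x\<close> both map
    \<open>?K\<close> bijectively onto the objects with price \<open>p (e k)\<close>.\<close>
  have "(\<Sum>j\<in>?K. q (e j)) < (\<Sum>j\<in>?K. q (x j))"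
  proof (rule sum_strict_mono_ex1)
    show "finite ?K" using N by simp
    show "\<forall>j\<in>?K. q (e j) \<le> q (x j)" using step qy by force
    show "\<exists>j\<in>?K. q (e j) < q (x j)" using k(1) step by auto
  qed
  moreover have "(\<Sum>j\<in>?K. q (x j)) = sum q {c \<in> Obj. p c = p (e k)}"
  proof (rule sum.reindex_bij_betw)
    show "bij_betw x ?K {c \<in> Obj. p c = p (e k)}"
      using xb px unfolding bij_betw_def inj_on_def by force
  qed
  moreover have "(\<Sum>j\<in>?K. q (e j)) = sum q {c \<in> Obj. p c = p (e k)}"
  proof (rule sum.reindex_bij_betw)
    show "bij_betw e ?K {c \<in> Obj. p c = p (e k)}"
      using e unfolding bij_betw_def inj_on_def by force
  qed
  ultimately show False by simp
qed

text \<open>An object that \<open>i\<close> likes better is dearer than \<open>e i\<close>. Its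
  holder under \<open>x\<close> lives strictly above the price level of \<open>i\<close>, where the
  report of \<open>i\<close> has no influence, and therefore keeps it.\<close>

lemma equilibrium_truthful:
  assumes e: "bij_betw e N Obj" and N: "finite N"
    and x: "equilibrium N Obj e P x p" and y: "equilibrium N Obj e (P(i := Q)) y q"
    and P: "\<And>i. i \<in> N \<Longrightarrow> P i \<in> prefs Obj" and i: "i \<in> N"
  shows "(y i, x i) \<notin> P i"
proof
  assume a: "(y i, x i) \<in> P i"
  have ya: "y \<in> allocations N Obj" using y by (simp add: equilibrium_def)
  have "y i \<in> Obj" using allocations_in[OF ya i] .
  then have lt: "p (e i) < p (y i)" using x a i by (auto simp: equilibrium_def)
  obtain l where l: "l \<in> N" "x l = y i"
    using x \<open>y i \<in> Obj\<close> by (auto simp: equilibrium_def allocations_def bij_betw_def)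
  then have pl: "p (e l) = p (y i)" using x by (auto simp: equilibrium_def)
  \<comment> \<open>Prices are integers, so the threshold \<open>p (e i) + 1\<close> leaves out
    \<open>i\<close>, the only agent whose preference changes, and still includes
    \<open>l\<close>.\<close>
  have "x l = y l"
    by (rule equilibrium_agree_above[OF e N x y P, where \<pi> = "p (e i) + 1"]) (use lt pl l in auto)
  then have "l = i" using l i allocations_bij[OF ya] by (auto simp: bij_betw_def inj_on_def)
  then show False using pl lt by simp
qed

text \<open>Later rounds carry lower prices.\<close>

lemma ttc_equilibrium:
  assumes e: "bij_betw e N Obj" and N: "finite N"
    and P: "\<And>i. i \<in> N \<Longrightarrow> P i \<in> prefs Obj"
  obtains p where "equilibrium N Obj e P (ttc N e P) p"
proof
  have inj: "inj_on e N" and eN: "e ` N = Obj" using e by (auto simp: bij_betw_def)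
  let ?R = "ttc_remaining N e P" and ?t = "ttc_round N e P"
  have leaves: "i \<in> ttc_leaving e P (?R (?t i))" if "i \<in> N" for i
    by (rule ttc_round_leaves[OF inj eN N]) (use P that in auto)
  have round_le: "?t j \<le> u" if "j \<in> ttc_leaving e P (?R u)" for j u
    unfolding ttc_round_def using that by (rule Least_le)
  have gone: "j \<in> N \<Longrightarrow> j \<notin> ?R u \<Longrightarrow> ?t j < u" for j u
  proof (induction u)
    case (Suc u)
    then show ?case using round_le[of j u] by (auto simp: less_Suc_eq)
  qed simp
  have same: "?t j = u" if "j \<in> ttc_leaving e P (?R u)" for j u
  proof (rule ccontr)
    assume "?t j \<noteq> u"
    then have "Suc (?t j) \<le> u" using round_le[OF that] by simp
    then have "?R u \<subseteq> ?R (Suc (?t j))" by (rule ttc_remaining_antimono)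
    moreover have "j \<in> ?R u" using that by (simp add: ttc_leaving_def)
    moreover have "j \<in> N" using \<open>j \<in> ?R u\<close> ttc_remaining_subset[of N e P] by blast
    ultimately show False using leaves[of j] by auto
  qed
  let ?p = "\<lambda>c. - int (?t (inv_into N e c))"
  have pe: "?p (e i) = - int (?t i)" if "i \<in> N" for i
    using that inj by simp
  show "equilibrium N Obj e P (ttc N e P) ?p"
    unfolding equilibrium_def
  proof (intro conjI ballI impI)
    show "ttc N e P \<in> allocations N Obj" by (rule ttc_in_allocations[OF e N P])
  next
    fix i assume i: "i \<in> N"
    have xi: "ttc N e P i = rank 1 (P i) (e ` ?R (?t i))" using i by (simp add: ttc_def)
    obtain j where j: "j \<in> ttc_leaving e P (?R (?t i))" "e j = ttc N e P i"
      using ttc_leaving_successor[OF leaves[OF i]] xi by metis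
    have "j \<in> N" using j(1) ttc_remaining_subset[of N e P] by (auto simp: ttc_leaving_def)
    then show "?p (ttc N e P i) = ?p (e i)"
      using same[OF j(1)] j(2) pe i by metis
    fix c assume c: "c \<in> Obj" "(c, ttc N e P i) \<in> P i"
    obtain k where k: "k \<in> N" "c = e k" using c(1) eN by auto
    \<comment> \<open>An object preferred to what \<open>i\<close> takes cannot be on the market in
      the round of \<open>i\<close>; it left in an earlier round and is thus dearer.\<close>
    have "k \<notin> ?R (?t i)"
    proof
      assume "k \<in> ?R (?t i)"
      moreover have "e ` ?R (?t i) \<subseteq> Obj" "finite (e ` ?R (?t i))"
        using ttc_remaining_subset[of N e P] eN N by (auto intro: finite_subset)
      ultimately have "c = ttc N e P i \<or> (ttc N e P i, c) \<in> P i"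
        using rank_1_preferred[OF P[OF i], of "e ` ?R (?t i)" c] k xi by auto
      then show False using c prefs_asym[OF P[OF i]] prefs_irrefl[OF P[OF i]] by blast
    qed
    then show "?p (e i) < ?p c" using gone[OF k(1)] k pe i by simp
  qed
qed


section \<open>Diverting the top trading cycle\<close>

locale market =
  fixes N :: "'i set" and Obj :: "'o set" and e :: "'i \<Rightarrow> 'o" and D :: "'o rel set"
    and S :: "'o set" and a b :: 'o
  assumes N: "finite N" and e: "bij_betw e N Obj" and D: "D \<subseteq> prefs Obj"
    and S: "S \<subseteq> Obj" and card_S: "card S \<le> 4"
    and a: "a \<in> S" and b: "b \<in> S" and ab: "a \<noteq> b"
    and not_ab: "\<And>P\<^sub>0. P\<^sub>0 \<in> D \<Longrightarrow> rank 1 P\<^sub>0 S = a \<Longrightarrow> rank 1 P\<^sub>0 (S - {a}) \<noteq> b"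
begin

definition owner :: "'o \<Rightarrow> 'i" where
  "owner c = inv_into N e c"

abbreviation TTC :: "('i \<Rightarrow> 'o rel) \<Rightarrow> 'i \<Rightarrow> 'o" where
  "TTC P \<equiv> ttc N e P"

text \<open>This makes precise that the outside trades by itself. Although it mentions the TTC
  outcome, it depends only on the reports of agents outside \<open>S\<close>, as
  \<open>separated_cong\<close> shows.\<close>

definition separated :: "('i \<Rightarrow> 'o rel) \<Rightarrow> bool" where
  "separated P \<longleftrightarrow> (\<forall>i \<in> N. e i \<notin> S \<longrightarrow> (\<forall>c \<in> S. (TTC P i, c) \<in> P i))"

definition swap_tops :: "('i \<Rightarrow> 'o rel) \<Rightarrow> bool" where
  "swap_tops P \<longleftrightarrow> separated P \<and> rank 1 (P (owner a)) S = b \<and> rank 1 (P (owner b)) S = a"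

text \<open>Since \<open>S\<close> has at most two objects other than \<open>a\<close> and \<open>b\<close>, this says that following best objects
  in \<open>S - {b}\<close> leads from each of them to \<open>a\<close>.\<close>

definition lead_to_a :: "('i \<Rightarrow> 'o rel) \<Rightarrow> bool" where
  "lead_to_a P \<longleftrightarrow> (\<forall>i \<in> N. e i \<in> S - {a, b} \<longrightarrow> rank 1 (P i) (S - {b}) \<noteq> e i) \<and>
     (\<exists>i \<in> N. e i \<in> S - {a, b} \<and> rank 1 (P i) (S - {b}) = a)"

text \<open>Sends an endowment to the object its owner receives, along the cycle from
  \<open>a\<close> to \<open>b\<close> to \<open>s\<close> to \<open>t\<close> and back to
  \<open>a\<close>. If \<open>t = a\<close>, the test \<open>c = a\<close> comes first and the cycle
  closes after \<open>s\<close>. Objects off the cycle stay with their owners.\<close>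

definition reroute :: "('i \<Rightarrow> 'o rel) \<Rightarrow> 'o \<Rightarrow> 'o" where
  "reroute P c =
     (let s = rank 1 (P (owner b)) (S - {a}); t = rank 1 (P (owner s)) (S - {b})
      in if c = a then b else if c = b then s else if c = s then t else if c = t then a else c)"

definition diverted :: "('i \<Rightarrow> 'o rel) \<Rightarrow> 'i \<Rightarrow> 'o" where
  "diverted P = (\<lambda>i \<in> N. if swap_tops P \<and> lead_to_a P \<and> e i \<in> S then reroute P (e i) else TTC P i)"

section \<open>Owners, profiles and best objects inside \<open>S\<close>\<close>

lemma fin_Obj: "finite Obj"
  using N e by (metis bij_betw_finite)

lemma fin_S: "finite S"
  using S fin_Obj by (rule finite_subset)

lemma owner_e [simp]: "i \<in> N \<Longrightarrow> owner (e i) = i"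
  using e by (simp add: owner_def bij_betw_def)

lemma owner_in: "c \<in> Obj \<Longrightarrow> owner c \<in> N"
  using e by (auto simp: owner_def bij_betw_def intro: inv_into_into)

lemma e_owner: "c \<in> Obj \<Longrightarrow> e (owner c) = c"
  using e by (simp add: owner_def bij_betw_def f_inv_into_f)

lemma e_in: "i \<in> N \<Longrightarrow> e i \<in> Obj"
  using e by (auto simp: bij_betw_def)

lemma profile_D: "P \<in> profiles N D \<Longrightarrow> i \<in> N \<Longrightarrow> P i \<in> D"
  by (auto simp: profiles_def)

lemma profile_prefs: "P \<in> profiles N D \<Longrightarrow> i \<in> N \<Longrightarrow> P i \<in> prefs Obj"
  using D by (auto simp: profiles_def)

lemma profile_upd: "P \<in> profiles N D \<Longrightarrow> i \<in> N \<Longrightarrow> Q \<in> D \<Longrightarrow> P(i := Q) \<in> profiles N D"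
  by (auto simp: profiles_def PiE_def extensional_def)

lemma best_in:
  assumes "P \<in> profiles N D" "i \<in> N" "U \<subseteq> S" "U \<noteq> {}"
  shows "rank 1 (P i) U \<in> U"
proof (rule rank_1_in)
  show "P i \<in> prefs Obj" by (rule profile_prefs) fact+
  show "U \<subseteq> Obj" "finite U" using assms S fin_S by (auto intro: finite_subset)
qed fact

lemma best_preferred:
  assumes "P \<in> profiles N D" "i \<in> N" "U \<subseteq> S" "c \<in> U" "c \<noteq> rank 1 (P i) U"
  shows "(rank 1 (P i) U, c) \<in> P i"
proof (rule rank_1_preferred)
  show "P i \<in> prefs Obj" by (rule profile_prefs) fact+
  show "U \<subseteq> Obj" "finite U" using assms S fin_S by (auto intro: finite_subset)
qed fact+

lemma best_not_beaten:
  assumes "P \<in> profiles N D" "i \<in> N" "U \<subseteq> S" "c \<in> U"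
  shows "(c, rank 1 (P i) U) \<notin> P i"
proof (cases "c = rank 1 (P i) U")
  case True
  then show ?thesis using prefs_irrefl[OF profile_prefs[OF assms(1,2)]] by simp
next
  case False
  then show ?thesis
    using prefs_asym[OF profile_prefs[OF assms(1,2)]] best_preferred[OF assms] by blast
qed

section \<open>Incentive properties of TTC\<close>

lemma TTC_equilibrium:
  assumes "P \<in> profiles N D"
  obtains p where "equilibrium N Obj e P (TTC P) p"
  using ttc_equilibrium[OF e N, of P] profile_prefs[OF assms] by blast

lemma TTC_allocation: "P \<in> profiles N D \<Longrightarrow> TTC P \<in> allocations N Obj"
  using TTC_equilibrium[of P] by (metis equilibrium_def)

lemma TTC_truthful:
  assumes "P \<in> profiles N D" "i \<in> N" "Q \<in> D"
  shows "(TTC (P(i := Q)) i, TTC P i) \<notin> P i"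
proof -
  obtain p where "equilibrium N Obj e P (TTC P) p" by (rule TTC_equilibrium[OF assms(1)])
  moreover obtain q where "equilibrium N Obj e (P(i := Q)) (TTC (P(i := Q))) q"
    by (rule TTC_equilibrium[OF profile_upd[OF assms]])
  ultimately show ?thesis
    using equilibrium_truthful[OF e N, of P _ _ i] profile_prefs[OF assms(1)] assms(2) by blast
qed

lemma TTC_rational:
  assumes P: "P \<in> profiles N D" and i: "i \<in> N"
  shows "weakly_pref (P i) (TTC P i) (e i)"
proof -
  obtain p where "equilibrium N Obj e P (TTC P) p" by (rule TTC_equilibrium[OF P])
  then have "(e i, TTC P i) \<notin> P i" "TTC P i \<in> Obj"
    using i e_in allocations_in by (fastforce simp: equilibrium_def)+
  then show ?thesis
    using prefs_total[OF profile_prefs[OF P i], of "e i" "TTC P i"] e_in[OF i]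
    by (auto simp: weakly_pref_def)
qed

section \<open>Markets in which the outside trades by itself\<close>

lemma separated_outside:
  assumes P: "P \<in> profiles N D" and sep: "separated P" and i: "i \<in> N" "e i \<notin> S"
  shows "TTC P i \<notin> S"
  using sep i prefs_irrefl[OF profile_prefs[OF P i(1)]] by (auto simp: separated_def)

lemma separated_bij_outside:
  assumes P: "P \<in> profiles N D" and sep: "separated P"
  shows "bij_betw (TTC P) {i \<in> N. e i \<notin> S} (Obj - S)"
proof -
  let ?W = "{i \<in> N. e i \<notin> S}"
  have inj: "inj_on (TTC P) N" using allocations_bij[OF TTC_allocation[OF P]] by (simp add: bij_betw_def)
  have "bij_betw e ?W (Obj - S)" using e unfolding bij_betw_def inj_on_def by auto
  then have "card ?W = card (Obj - S)" by (rule bij_betw_same_card)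
  moreover have "TTC P ` ?W \<subseteq> Obj - S"
    using separated_outside[OF P sep] allocations_in[OF TTC_allocation[OF P]] by auto
  moreover have "inj_on (TTC P) ?W" using inj by (rule inj_on_subset) auto
  ultimately show ?thesis
    using fin_Obj by (simp add: bij_betw_def card_image card_subset_eq)
qed

lemma separated_inside:
  assumes P: "P \<in> profiles N D" and sep: "separated P" and i: "i \<in> N" "e i \<in> S"
  shows "TTC P i \<in> S"
proof (rule ccontr)
  assume "TTC P i \<notin> S"
  then have "TTC P i \<in> Obj - S" using allocations_in[OF TTC_allocation[OF P] i(1)] by simp
  then have "TTC P i \<in> TTC P ` {j \<in> N. e j \<notin> S}"
    using separated_bij_outside[OF P sep] by (simp add: bij_betw_def)
  then obtain j where "j \<in> N" "e j \<notin> S" "TTC P j = TTC P i" by auto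
  then show False
    using allocations_bij[OF TTC_allocation[OF P]] i by (auto simp: bij_betw_def inj_on_def)
qed

text \<open>Raising the prices of all objects outside \<open>S\<close> above those in \<open>S\<close> keeps the equilibrium.\<close>

lemma separated_prices:
  assumes P: "P \<in> profiles N D" and sep: "separated P"
  obtains p \<pi> where "equilibrium N Obj e P (TTC P) p"
    "\<And>c. c \<in> Obj \<Longrightarrow> \<pi> \<le> p c \<longleftrightarrow> c \<notin> S"
proof -
  obtain p where p: "equilibrium N Obj e P (TTC P) p" by (rule TTC_equilibrium[OF P])
  \<comment> \<open>\<open>?K\<close> exceeds every price in absolute value, so adding
    \<open>2 * ?K\<close> outside \<open>S\<close> makes \<open>?K\<close> itself a threshold
    between the two groups.\<close>
  let ?K = "\<Sum>c\<in>Obj. \<bar>p c\<bar> + 1"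
  have K: "\<bar>p c\<bar> + 1 \<le> ?K" if "c \<in> Obj" for c
    using fin_Obj that by (intro member_le_sum) auto
  let ?p = "\<lambda>c. if c \<in> S then p c else p c + 2 * ?K"
  have "equilibrium N Obj e P (TTC P) ?p"
    unfolding equilibrium_def
  proof (intro conjI ballI impI)
    show "TTC P \<in> allocations N Obj" by (rule TTC_allocation[OF P])
  next
    fix i assume i: "i \<in> N"
    show "?p (TTC P i) = ?p (e i)"
      using p i separated_outside[OF P sep i] separated_inside[OF P sep i] by (auto simp: equilibrium_def)
    fix c assume c: "c \<in> Obj" "(c, TTC P i) \<in> P i"
    then have lt: "p (e i) < p c" using p i by (simp add: equilibrium_def)
    have "c \<notin> S" if "e i \<notin> S"
      using sep i that c prefs_asym[OF profile_prefs[OF P i]] by (auto simp: separated_def)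
    then show "?p (e i) < ?p c" using lt K[OF c(1)] by auto
  qed
  moreover have "?K \<le> ?p c \<longleftrightarrow> c \<notin> S" if "c \<in> Obj" for c
    using K[OF that] by auto
  ultimately show ?thesis by (rule that)
qed

text \<open>With every outside object at or above the threshold \<pi> and every object of
  \<open>S\<close> below it, \<open>equilibrium_agree_above\<close> fixes the outside outcomes from
  the outside preferences alone.\<close>

lemma separated_cong:
  assumes P: "P \<in> profiles N D" and P': "P' \<in> profiles N D" and sep: "separated P"
    and eq: "\<And>i. i \<in> N \<Longrightarrow> e i \<notin> S \<Longrightarrow> P i = P' i"
  shows "separated P'"
proof -
  obtain p \<pi> where p: "equilibrium N Obj e P (TTC P) p"
    "\<And>c. c \<in> Obj \<Longrightarrow> \<pi> \<le> p c \<longleftrightarrow> c \<notin> S" by (rule separated_prices[OF P sep]) blast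
  obtain q where q: "equilibrium N Obj e P' (TTC P') q" by (rule TTC_equilibrium[OF P'])
  have "TTC P i = TTC P' i" if "i \<in> N" "e i \<notin> S" for i
    by (rule equilibrium_agree_above[OF e N p(1) q profile_prefs[OF P], where \<pi> = \<pi>])
      (use p(2) that eq e_in in auto)
  then show ?thesis using sep eq unfolding separated_def by auto
qed

lemma separated_upd:
  assumes P: "P \<in> profiles N D" and i: "i \<in> N" "e i \<in> S" and Q: "Q \<in> D"
  shows "separated (P(i := Q)) \<longleftrightarrow> separated P"
proof -
  note P' = profile_upd[OF P i(1) Q]
  have "P j = (P(i := Q)) j" if "e j \<notin> S" for j using that i by auto
  then show ?thesis
    using separated_cong[OF P P'] separated_cong[OF P' P] by metis
qed

text \<open>Prices never fall along a pointing edge and rise strictly when the pointing agent misses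
  its best object. Around a pointing cycle no rise is possible, so everyone on it is served; the
  next two lemmas are the cycles of length one and two. \<open>U\<close> can be any part of
  \<open>S\<close> known to contain the outcome, such as \<open>S - {b}\<close>.\<close>

lemma price_best:
  assumes P: "P \<in> profiles N D" and p: "equilibrium N Obj e P (TTC P) p"
    and i: "i \<in> N" and U: "U \<subseteq> S" "TTC P i \<in> U"
  shows "TTC P i = rank 1 (P i) U \<and> p (e i) = p (rank 1 (P i) U) \<or> p (e i) < p (rank 1 (P i) U)"
proof (cases "TTC P i = rank 1 (P i) U")
  case True
  then show ?thesis using p i by (auto simp: equilibrium_def)
next
  case False
  then have "(rank 1 (P i) U, TTC P i) \<in> P i" using best_preferred[OF P i U] by simp
  moreover have "rank 1 (P i) U \<in> Obj" using best_in[OF P i U(1)] U S by auto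
  ultimately show ?thesis using p i by (auto simp: equilibrium_def)
qed

lemma TTC_best_own:
  assumes P: "P \<in> profiles N D" and i: "i \<in> N"
    and U: "U \<subseteq> S" "TTC P i \<in> U" "rank 1 (P i) U = e i"
  shows "TTC P i = e i"
  using TTC_equilibrium[OF P] price_best[OF P _ i U(1,2)] U(3) by (metis order.irrefl)

lemma TTC_best_mutual:
  assumes P: "P \<in> profiles N D" and i: "i \<in> N" and j: "j \<in> N"
    and U: "U \<subseteq> S" "TTC P i \<in> U" "rank 1 (P i) U = e j"
    and V: "V \<subseteq> S" "TTC P j \<in> V" "rank 1 (P j) V = e i"
  shows "TTC P i = e j"
proof -
  obtain p where p: "equilibrium N Obj e P (TTC P) p" by (rule TTC_equilibrium[OF P])
  show ?thesis
    using price_best[OF P p i U(1,2)] price_best[OF P p j V(1,2)] U(3) V(3) by auto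
qed

lemma swap_topsD:
  assumes P: "P \<in> profiles N D" and sw: "swap_tops P"
  shows "TTC P (owner a) = b" "TTC P (owner b) = a"
proof -
  have o: "owner a \<in> N" "owner b \<in> N" "e (owner a) = a" "e (owner b) = b"
    using a b S owner_in e_owner by auto
  have s: "TTC P (owner a) \<in> S" "TTC P (owner b) \<in> S"
    using separated_inside[OF P] sw o a b by (auto simp: swap_tops_def)
  show "TTC P (owner a) = b" "TTC P (owner b) = a"
    using TTC_best_mutual[OF P o(1,2) subset_refl s(1) _ subset_refl s(2)]
      TTC_best_mutual[OF P o(2,1) subset_refl s(2) _ subset_refl s(1)] sw o
    by (auto simp: swap_tops_def)
qed

lemma swap_tops_other:
  assumes P: "P \<in> profiles N D" and sw: "swap_tops P" and i: "i \<in> N" "e i \<in> S - {a, b}"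
  shows "TTC P i \<in> S - {a, b}"
proof -
  have "TTC P i \<in> S" using separated_inside[OF P] sw i by (auto simp: swap_tops_def)
  moreover have "i \<noteq> owner a" "i \<noteq> owner b" using i a b S e_owner by auto
  moreover have "inj_on (TTC P) N"
    using allocations_bij[OF TTC_allocation[OF P]] by (simp add: bij_betw_def)
  ultimately show ?thesis
    using swap_topsD[OF P sw] i a b S owner_in by (metis DiffI inj_onD insertE singletonD subsetD)
qed

section \<open>The rerouted cycle and the allocation it produces\<close>

definition second :: "('i \<Rightarrow> 'o rel) \<Rightarrow> 'o" where
  "second P = rank 1 (P (owner b)) (S - {a})"

definition third :: "('i \<Rightarrow> 'o rel) \<Rightarrow> 'o" where
  "third P = rank 1 (P (owner (second P))) (S - {b})"

lemma reroute_eq: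
  "reroute P c = (if c = a then b else if c = b then second P else if c = second P then third P
    else if c = third P then a else c)"
  by (simp add: reroute_def second_def third_def)

text \<open>Here the failure of the top-two condition is used: a preference in \<open>D\<close> with
  \<open>a\<close> on top of \<open>S\<close> cannot have \<open>b\<close> next.\<close>

lemma second_in:
  assumes P: "P \<in> profiles N D" and sw: "swap_tops P"
  shows "second P \<in> S - {a, b}"
proof -
  have o: "owner b \<in> N" using b S owner_in by auto
  have "second P \<in> S - {a}" unfolding second_def
    by (rule best_in[OF P o]) (use b ab in auto)
  moreover have "second P \<noteq> b"
    using not_ab[OF profile_D[OF P o]] sw by (auto simp: swap_tops_def second_def)
  ultimately show ?thesis by auto
qed

lemma third_in:
  assumes P: "P \<in> profiles N D" and sw: "swap_tops P" and lead: "lead_to_a P"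
  shows "third P \<in> S - {b}" "third P \<noteq> second P"
proof -
  have s: "second P \<in> S - {a, b}" by (rule second_in[OF P sw])
  then have o: "owner (second P) \<in> N" "e (owner (second P)) = second P"
    using S owner_in e_owner by auto
  show "third P \<in> S - {b}" unfolding third_def
    by (rule best_in[OF P o(1)]) (use s in auto)
  show "third P \<noteq> second P" using lead o s by (auto simp: lead_to_a_def third_def)
qed

text \<open>Here the bound \<open>card S \<le> 4\<close> is used: besides \<open>a\<close>,
  \<open>b\<close> and \<open>s\<close> there is room for one more object.\<close>

lemma S_cases:
  assumes "s \<in> S - {a, b}"
  obtains "S = {a, b, s}" | u where "S = {a, b, s, u}" "u \<notin> {a, b, s}"
proof (cases "S = {a, b, s}")
  case False
  then obtain u where u: "u \<in> S" "u \<notin> {a, b, s}" using assms a b by blast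
  then have "card {a, b, s, u} = 4" using assms ab by auto
  then have "{a, b, s, u} = S"
    using card_S fin_S u assms a b by (intro card_seteq) auto
  then show ?thesis using that u by metis
qed (use that in blast)


lemma S_eq:
  assumes s: "s \<in> S - {a, b}" and u: "u \<in> S - {a, b}" "u \<noteq> s"
  shows "S = {a, b, s, u}"
  by (rule S_cases[OF s]) (use u in auto)

lemma diverted_off: "i \<in> N \<Longrightarrow> \<not> (swap_tops P \<and> lead_to_a P \<and> e i \<in> S) \<Longrightarrow> diverted P i = TTC P i"
  by (auto simp: diverted_def)

lemma diverted_on:
  "i \<in> N \<Longrightarrow> swap_tops P \<Longrightarrow> lead_to_a P \<Longrightarrow> e i \<in> S \<Longrightarrow> diverted P i = reroute P (e i)"
  by (simp add: diverted_def)

lemma reroute_bij: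
  assumes P: "P \<in> profiles N D" and sw: "swap_tops P" and lead: "lead_to_a P"
  shows "bij_betw (reroute P) S S"
proof -
  note s = second_in[OF P sw] and t = third_in[OF P sw lead]
  have "reroute P ` S = S"
  proof (rule S_cases[OF s])
    assume S3: "S = {a, b, second P}"
    then have "third P = a" using t by auto
    then show ?thesis using S3 s ab by (auto simp: reroute_eq)
  next
    fix u assume S4: "S = {a, b, second P, u}" "u \<notin> {a, b, second P}"
    then have "third P = a \<or> third P = u" using t by auto
    then show ?thesis
    proof
      assume "third P = a"
      then show ?thesis using S4 s ab by (auto simp: reroute_eq)
    next
      assume "third P = u"
      then show ?thesis using S4 s ab by (auto simp: reroute_eq)
    qed
  qed
  then show ?thesis
    using fin_S by (simp add: bij_betw_def eq_card_imp_inj_on)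
qed

lemma diverted_inside:
  assumes P: "P \<in> profiles N D" and sep: "separated P" and i: "i \<in> N" "e i \<in> S"
  shows "diverted P i \<in> S"
proof (cases "swap_tops P \<and> lead_to_a P")
  case True
  then show ?thesis
    using reroute_bij[OF P] i by (auto simp: diverted_on bij_betw_def)
next
  case False
  then show ?thesis using separated_inside[OF P sep i] i by (simp add: diverted_off)
qed

lemma diverted_allocation:
  assumes P: "P \<in> profiles N D"
  shows "diverted P \<in> allocations N Obj"
proof (cases "swap_tops P \<and> lead_to_a P")
  case True
  then have sep: "separated P" by (simp add: swap_tops_def)
  let ?M = "{i \<in> N. e i \<in> S}" and ?W = "{i \<in> N. e i \<notin> S}"
  have "bij_betw e ?M S" using e S unfolding bij_betw_def inj_on_def by auto
  then have "bij_betw (reroute P \<circ> e) ?M S"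
    using reroute_bij[OF P] True by (intro bij_betw_trans) auto
  then have M: "bij_betw (diverted P) ?M S"
    by (rule bij_betw_cong[THEN iffD1, rotated]) (use True in \<open>simp add: diverted_on\<close>)
  have W: "bij_betw (diverted P) ?W (Obj - S)"
    using separated_bij_outside[OF P sep]
    by (rule bij_betw_cong[THEN iffD1, rotated]) (simp add: diverted_off)
  have "bij_betw (diverted P) (?M \<union> ?W) (S \<union> (Obj - S))"
    by (rule bij_betw_combine[OF M W]) auto
  moreover have "?M \<union> ?W = N" "S \<union> (Obj - S) = Obj" using S by auto
  ultimately have "bij_betw (diverted P) N Obj" by simp
  then show ?thesis
    by (auto simp: allocations_def PiE_def diverted_def dest: bij_betw_imp_surj_on)
next
  case False
  then have "diverted P = TTC P"
    using TTC_allocation[OF P]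
    by (auto simp: diverted_def allocations_def PiE_def extensional_def fun_eq_iff)
  then show ?thesis using TTC_allocation[OF P] by simp
qed

text \<open>Records for every agent inside \<open>S\<close> the set in which the assigned object is
  best. The last alternative is the fourth agent when the cycle closes without it.\<close>

lemma diverted_cases:
  assumes P: "P \<in> profiles N D" and sw: "swap_tops P" and lead: "lead_to_a P"
    and i: "i \<in> N" "e i \<in> S"
  obtains "i = owner a" "diverted P i = b" "rank 1 (P i) S = b"
  | "i = owner b" "diverted P i = second P" "rank 1 (P i) (S - {a}) = second P"
  | "e i \<in> S - {a, b}" "diverted P i \<in> {a, third P}" "rank 1 (P i) (S - {b}) = diverted P i"
  | "e i \<in> S - {a, b, second P}" "diverted P i = e i" "third P = a"
proof -
  note s = second_in[OF P sw] and t = third_in[OF P sw lead]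
  have div: "diverted P i = reroute P (e i)" using diverted_on[OF i(1) sw lead i(2)] .
  have own: "owner (e i) = i" using i by simp
  consider "e i = a" | "e i = b" | "e i = second P" | "e i \<notin> {a, b, second P}" by blast
  then show ?thesis
  proof cases
    case 1
    then show ?thesis using that(1) div own sw by (auto simp: reroute_eq swap_tops_def)
  next
    case 2
    then show ?thesis using that(2) div own ab by (auto simp: reroute_eq second_def)
  next
    case 3
    then show ?thesis using that(3) div own s i by (auto simp: reroute_eq third_def)
  next
    case 4
    show ?thesis
    proof (cases "e i = third P")
      case True
      obtain u where u: "S = {a, b, second P, u}" "u \<notin> {a, b, second P}"
        using S_cases[OF s] 4 i by blast
      then have "u = e i" using 4 i by auto
      \<comment> \<open>The owner of \<open>second P\<close> points to \<open>third P\<close>, which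
        is not \<open>a\<close> here. So the agent that \<open>lead_to_a\<close> provides must be
        the owner of the fourth object.\<close>
      obtain j where j: "j \<in> N" "e j \<in> S - {a, b}" "rank 1 (P j) (S - {b}) = a"
        using lead by (auto simp: lead_to_a_def)
      have "e j \<noteq> second P"
        using j True 4 by (metis owner_e third_def insertI1)
      then have "e j = e i" using j u \<open>u = e i\<close> by auto
      then have "rank 1 (P i) (S - {b}) = a" using j own by (metis owner_e)
      then show ?thesis using that(3) div 4 i True by (auto simp: reroute_eq)
    next
      case False
      then have "third P = a" using S_cases[OF s] t 4 i by blast
      then show ?thesis using that(4) div 4 i False by (auto simp: reroute_eq)
    qed
  qed
qed

section \<open>Individual rationality and Pareto efficiency of the diverted rule\<close>

lemma weakly_pref_best:
  assumes "P \<in> profiles N D" "i \<in> N" "U \<subseteq> S" "c \<in> U"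
  shows "weakly_pref (P i) (rank 1 (P i) U) c"
  using best_preferred[OF assms] by (auto simp: weakly_pref_def)

lemma diverted_rational:
  assumes P: "P \<in> profiles N D" and i: "i \<in> N"
  shows "weakly_pref (P i) (diverted P i) (e i)"
proof (cases "swap_tops P \<and> lead_to_a P \<and> e i \<in> S")
  case True
  then have sw: "swap_tops P" and lead: "lead_to_a P" and S': "e i \<in> S" by auto
  show ?thesis
  proof (rule diverted_cases[OF P sw lead i S'])
    assume "i = owner b" "diverted P i = second P" "rank 1 (P i) (S - {a}) = second P"
    then show ?thesis
      using weakly_pref_best[OF P i, of "S - {a}" b] b ab S e_owner by auto
  qed (use weakly_pref_best[OF P i, of S "e i"] weakly_pref_best[OF P i, of "S - {b}" "e i"] S' in
      \<open>auto simp: weakly_pref_def\<close>)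
next
  case False
  then show ?thesis using TTC_rational[OF P i] by (simp add: diverted_off[OF i])
qed

lemma diverted_efficient:
  assumes P: "P \<in> profiles N D" and y: "y \<in> allocations N Obj"
    and w: "\<forall>i \<in> N. weakly_pref (P i) (y i) (diverted P i)"
  shows "\<not> (\<exists>j \<in> N. (y j, diverted P j) \<in> P j)"
proof (cases "swap_tops P \<and> lead_to_a P")
  case True
  then have sw: "swap_tops P" and lead: "lead_to_a P" and sep: "separated P"
    by (auto simp: swap_tops_def)
  note s = second_in[OF P sw] and t = third_in[OF P sw lead]
  obtain p \<pi> where p: "equilibrium N Obj e P (TTC P) p"
    and \<pi>: "\<And>c. c \<in> Obj \<Longrightarrow> \<pi> \<le> p c \<longleftrightarrow> c \<notin> S" by (rule separated_prices[OF P sep]) blast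
  \<comment> \<open>Below the outside prices, objects of \<open>S\<close> are ranked so that each
    agent misses only dearer ones: nothing in \<open>S\<close> beats \<open>b\<close> for its
    recipient, only \<open>a\<close> can beat \<open>second P\<close>, and only \<open>b\<close> can
    beat \<open>a\<close> or \<open>third P\<close>. A fourth agent left out of the cycle holds the
    cheapest object.\<close>
  define q where "q c = (if c \<notin> S then p c else if c = b then \<pi> - 1
    else if c = a \<or> c = third P then \<pi> - 2 else if c = second P then \<pi> - 3 else \<pi> - 4)" for c
  show ?thesis
  proof (rule efficient_if_supported[OF N diverted_allocation[OF P] y _ w])
    fix i c assume i: "i \<in> N" and c: "c \<in> Obj" "(c, diverted P i) \<in> P i"
    show "q (diverted P i) < q c"
    proof (cases "e i \<in> S")
      case False
      then have d: "diverted P i = TTC P i" using i by (simp add: diverted_off)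
      then have "c \<notin> S"
        using sep i False c prefs_asym[OF profile_prefs[OF P i]] by (auto simp: separated_def)
      moreover have "p (TTC P i) < p c" using p i c d by (auto simp: equilibrium_def)
      ultimately show ?thesis
        using separated_outside[OF P sep i False] d by (simp add: q_def)
    next
      case True
      have dS: "diverted P i \<in> S" by (rule diverted_inside[OF P sep i True])
      show ?thesis
      proof (cases "c \<in> S")
        case False
        then show ?thesis using dS \<pi>[OF c(1)] by (auto simp: q_def)
      next
        case cS: True
        have ne: "c \<noteq> diverted P i" using c prefs_irrefl[OF profile_prefs[OF P i]] by metis
        show ?thesis
        proof (rule diverted_cases[OF P sw lead i True])
          assume "diverted P i = b" "rank 1 (P i) S = b"
          then show ?thesis using best_not_beaten[OF P i subset_refl cS] c by simp
        next
          assume d: "diverted P i = second P" "rank 1 (P i) (S - {a}) = second P"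
          then have "c = a" using best_not_beaten[OF P i, of "S - {a}" c] c cS by auto
          then show ?thesis using d s t ab a by (auto simp: q_def)
        next
          assume d: "diverted P i \<in> {a, third P}" "rank 1 (P i) (S - {b}) = diverted P i"
          then have "c = b" using best_not_beaten[OF P i, of "S - {b}" c] c cS by auto
          then show ?thesis using d t ab a b by (auto simp: q_def)
        next
          assume d: "e i \<in> S - {a, b, second P}" "diverted P i = e i" "third P = a"
          then have "c = a \<or> c = b \<or> c = second P"
            using S_eq[OF s, of "e i"] cS ne by auto
          then show ?thesis using d s t a b ab by (auto simp: q_def)
        qed
      qed
    qed
  qed
next
  case False
  obtain p where "equilibrium N Obj e P (TTC P) p" by (rule TTC_equilibrium[OF P])
  then show ?thesis
    using efficient_if_supported[OF N diverted_allocation[OF P] y _ w, of p] False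
    by (auto simp: diverted_off equilibrium_def)
qed

section \<open>Strategyproofness of the diverted rule\<close>

text \<open>While the others pass \<open>a\<close> along, the owner of \<open>b\<close> cannot obtain it by hiding that it is best.\<close>

lemma TTC_owner_b_best:
  assumes P: "P \<in> profiles N D" and sep: "separated P" and lead: "lead_to_a P"
    and A: "rank 1 (P (owner a)) S = b" and B: "rank 1 (P (owner b)) S \<noteq> a"
  shows "TTC P (owner b) = rank 1 (P (owner b)) S"
proof (rule ccontr)
  assume ne: "TTC P (owner b) \<noteq> rank 1 (P (owner b)) S"
  obtain p where p: "equilibrium N Obj e P (TTC P) p" by (rule TTC_equilibrium[OF P])
  have o: "owner a \<in> N" "owner b \<in> N" "e (owner a) = a" "e (owner b) = b"
    using a b S owner_in e_owner by auto
  have ins: "TTC P i \<in> S" if "i \<in> N" "e i \<in> S" for i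
    by (rule separated_inside[OF P sep that])
  have lt: "p b < p (rank 1 (P (owner b)) S)"
    using price_best[OF P p o(2) subset_refl ins] ne o b by auto
  have pa: "p a \<le> p b"
    using price_best[OF P p o(1) subset_refl ins] A o a by auto
  \<comment> \<open>The first alternative covers an agent to whom TTC gives \<open>b\<close> itself,
    an outcome outside \<open>S - {b}\<close>.\<close>
  have step: "p (e i) \<le> p b \<or> p (e i) \<le> p (rank 1 (P i) (S - {b}))" if i: "i \<in> N" "e i \<in> S" for i
  proof (cases "TTC P i = b")
    case True
    then show ?thesis using p i by (auto simp: equilibrium_def)
  next
    case False
    then show ?thesis using price_best[OF P p i(1), of "S - {b}"] ins[OF i] by auto
  qed
  \<comment> \<open>Following best objects from \<open>c\<close> reaches \<open>a\<close> in at most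
    two edges, and \<open>a\<close> costs at most \<open>p b\<close>. So nothing the owner of
    \<open>b\<close> could have missed is dearer than \<open>b\<close>.\<close>
  have le: "p c \<le> p b" if c: "c \<in> S - {a, b}" for c
  proof -
    have oc: "owner c \<in> N" "e (owner c) = c" using c S owner_in e_owner by auto
    let ?d = "rank 1 (P (owner c)) (S - {b})"
    have d: "?d \<in> S - {b}" using best_in[OF P oc(1), of "S - {b}"] c by auto
    show ?thesis
    proof (cases "?d = a")
      case True
      then show ?thesis using step[OF oc(1)] oc c pa by auto
    next
      case False
      moreover have "?d \<noteq> c" using lead oc c by (auto simp: lead_to_a_def)
      ultimately have d': "?d \<in> S - {a, b}" "S = {a, b, c, ?d}"
        using d S_eq[OF c, of ?d] by simp_all
      obtain j where j: "j \<in> N" "e j \<in> S - {a, b}" "rank 1 (P j) (S - {b}) = a"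
        using lead by (auto simp: lead_to_a_def)
      have "e j \<noteq> c" using j False by (metis owner_e)
      then have "e j = ?d" using j d' by blast
      then have "p ?d \<le> p b" using step[OF j(1)] j pa by auto
      then show ?thesis using step[OF oc(1)] oc c by auto
    qed
  qed
  have "rank 1 (P (owner b)) S \<in> S" using best_in[OF P o(2) subset_refl] a by auto
  then show False using lt le[of "rank 1 (P (owner b)) S"] B
    by (cases "rank 1 (P (owner b)) S = b") auto
qed

lemma diverted_other_not_b:
  assumes P: "P \<in> profiles N D" and sw: "swap_tops P" and i: "i \<in> N" "e i \<in> S - {a, b}"
  shows "diverted P i \<in> S - {b}"
proof (cases "lead_to_a P")
  case True
  have iS: "e i \<in> S" using i by simp
  have eo: "e (owner a) = a" "e (owner b) = b" using a b S e_owner by auto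
  show ?thesis
    by (rule diverted_cases[OF P sw True i(1) iS]) (use i eo third_in[OF P sw True] a ab in auto)
next
  case False
  then show ?thesis using swap_tops_other[OF P sw i] i by (simp add: diverted_off)
qed

text \<open>If the owner of \<open>second P\<close> points to \<open>a\<close>, the fourth agent is
  off the rerouted cycle. The only way it can make \<open>lead_to_a\<close> fail is by pointing to
  its own object, and then TTC leaves it that object too.\<close>

lemma diverted_other_own:
  assumes P: "P \<in> profiles N D" and sw: "swap_tops P"
    and i: "i \<in> N" "e i \<in> S - {a, b}" "e i \<noteq> second P" and t: "third P = a"
  shows "diverted P i = e i"
proof (cases "lead_to_a P")
  case True
  then show ?thesis using diverted_on[OF i(1) sw] i t by (auto simp: reroute_eq)
next
  case False
  note s = second_in[OF P sw]
  have os: "owner (second P) \<in> N" "e (owner (second P)) = second P"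
    using s S owner_in e_owner by auto
  have "rank 1 (P i) (S - {b}) = e i"
  proof (rule ccontr)
    assume ne: "rank 1 (P i) (S - {b}) \<noteq> e i"
    have "rank 1 (P j) (S - {b}) \<noteq> e j" if j: "j \<in> N" "e j \<in> S - {a, b}" for j
    proof -
      have "e j = second P \<or> e j = e i" using S_eq[OF s i(2,3)] j by blast
      then show ?thesis using t ne i j s third_def by (metis owner_e DiffD2 insertI1)
    qed
    moreover have "rank 1 (P (owner (second P))) (S - {b}) = a" using t by (simp add: third_def)
    ultimately show False using False os s by (auto simp: lead_to_a_def)
  qed
  then show ?thesis
    using TTC_best_own[OF P i(1), of "S - {b}"] swap_tops_other[OF P sw i(1,2)] False i
    by (auto simp: diverted_off)
qed

text \<open>Each alternative rules out manipulation by \<open>i\<close>: the best object other than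
  \<open>b\<close>; another agent's self-loop, which blocks \<open>lead_to_a\<close> whatever
  \<open>i\<close> reports; or the situation of \<open>diverted_other_own\<close>.\<close>

lemma diverted_other_cases:
  assumes P: "P \<in> profiles N D" and sw: "swap_tops P" and i: "i \<in> N" "e i \<in> S - {a, b}"
  obtains "diverted P i = rank 1 (P i) (S - {b})"
  | j where "j \<in> N" "e j \<in> S - {a, b}" "j \<noteq> i" "rank 1 (P j) (S - {b}) = e j"
  | "e i \<noteq> second P" "third P = a"
proof (cases "lead_to_a P")
  case True
  have S': "e i \<in> S" using i by simp
  show ?thesis
    by (rule diverted_cases[OF P sw True i(1) S'])
      (use that i a b S e_owner in \<open>auto simp: subset_iff\<close>)
next
  case False
  have d: "diverted P i = TTC P i" using i False by (simp add: diverted_off)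
  have T: "TTC P j \<in> S - {b}" if "j \<in> N" "e j \<in> S - {a, b}" for j
    using swap_tops_other[OF P sw that] by auto
  let ?u = "rank 1 (P i) (S - {b})"
  show ?thesis
  proof (cases "?u = e i")
    case True
    then show ?thesis
      using that(1) d TTC_best_own[OF P i(1) _ T[OF i]] by auto
  next
    case own: False
    show ?thesis
    proof (cases "\<exists>j\<in>N. e j \<in> S - {a, b} \<and> j \<noteq> i \<and> rank 1 (P j) (S - {b}) = e j")
      case True
      then show ?thesis using that(2) by blast
    next
      case loops: False
      \<comment> \<open>Without self-loops, \<open>lead_to_a\<close> can fail only because nobody
        points to \<open>a\<close>. Then \<open>i\<close> and the owner of the fourth object point
        to each other, and TTC executes that swap.\<close>
      then have none: "rank 1 (P j) (S - {b}) \<noteq> a" if "j \<in> N" "e j \<in> S - {a, b}" for j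
        using own False that unfolding lead_to_a_def by metis
      have u: "?u \<in> S - {b}" using best_in[OF P i(1), of "S - {b}"] i by auto
      then have u': "?u \<in> S - {a, b}" "S = {a, b, e i, ?u}"
        using none[OF i] own S_eq[OF i(2), of ?u] by simp_all
      define j where "j = owner ?u"
      have j: "j \<in> N" "e j = ?u" using u S owner_in e_owner unfolding j_def by auto
      have jT: "e j \<in> S - {a, b}" using j u' by simp
      have "rank 1 (P j) (S - {b}) \<in> S - {b}"
        using best_in[OF P j(1), of "S - {b}"] i by auto
      moreover have "rank 1 (P j) (S - {b}) \<noteq> e j"
        using loops j jT own by metis
      moreover have "S = {a, b, e i, e j}" using u'(2) j(2) by simp
      ultimately have "rank 1 (P j) (S - {b}) = e i"
        using none[OF j(1) jT] by blast
      then have "TTC P i = e j"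
        using TTC_best_mutual[OF P i(1) j(1) _ T[OF i] _ _ T[OF j(1) jT]] j by auto
      then show ?thesis using that(1) d j by simp
    qed
  qed
qed

lemma diverted_truthful:
  assumes P: "P \<in> profiles N D" and i: "i \<in> N" and Q: "Q \<in> D"
  shows "(diverted (P(i := Q)) i, diverted P i) \<notin> P i"
proof -
  let ?P' = "P(i := Q)"
  note P' = profile_upd[OF P i Q] and TTC = TTC_truthful[OF P i Q]
  have oN: "owner a \<in> N" "owner b \<in> N" and eo: "e (owner a) = a" "e (owner b) = b"
    using a b S owner_in e_owner by auto
  have best: ?thesis if "diverted P i = rank 1 (P i) U" "diverted ?P' i \<in> U" "U \<subseteq> S" for U
    using best_not_beaten[OF P i that(3,2)] that(1) by simp
  show ?thesis
  proof (cases "separated P \<and> e i \<in> S")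
    case False
    then have "\<not> (swap_tops P \<and> lead_to_a P \<and> e i \<in> S)"
        "\<not> (swap_tops ?P' \<and> lead_to_a ?P' \<and> e i \<in> S)"
      using separated_upd[OF P i _ Q] by (auto simp: swap_tops_def)
    then show ?thesis using TTC by (auto simp: diverted_off[OF i])
  next
    case True
    then have sep: "separated P" "separated ?P'" and iS: "e i \<in> S"
      using separated_upd[OF P i _ Q] by auto
    note inside = diverted_inside[OF P' sep(2) i iS]
    consider "e i = a" | "e i = b" | "e i \<in> S - {a, b}" using iS by blast
    then show ?thesis
    proof cases
      case 1
      then have ia: "i = owner a" using i by (metis owner_e)
      show ?thesis
      proof (cases "swap_tops P \<and> lead_to_a P")
        case True
        then have "diverted P i = b"
          using 1 iS by (simp add: diverted_on[OF i] reroute_eq)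
        moreover have "rank 1 (P i) S = b" using True ia by (simp add: swap_tops_def)
        ultimately have "diverted P i = rank 1 (P i) S" by simp
        then show ?thesis using best[OF _ inside subset_refl] by blast
      next
        case False
        \<comment> \<open>The diversion never changes what the owner of \<open>a\<close> receives:
          TTC gives \<open>b\<close> as well, so a misreport yields no more than under TTC.\<close>
        have "diverted ?P' i = TTC ?P' i"
        proof (cases "swap_tops ?P' \<and> lead_to_a ?P'")
          case True
          then have "diverted ?P' i = b"
            using 1 iS by (simp add: diverted_on[OF i] reroute_eq)
          moreover have "TTC ?P' i = b" using swap_topsD(1)[OF P'] True ia by metis
          ultimately show ?thesis by simp
        qed (use diverted_off[OF i] in blast)
        then show ?thesis using False TTC by (auto simp: diverted_off[OF i])
      qed
    next
      case 2
      then have ib: "i = owner b" using i by (metis owner_e)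
      have oa: "owner a \<noteq> i" using eo 2 ab by auto
      have lead: "lead_to_a ?P' \<longleftrightarrow> lead_to_a P"
        using 2 by (auto simp: lead_to_a_def)
      show ?thesis
      proof (cases "lead_to_a P \<and> rank 1 (P (owner a)) S = b")
        case False
        then have "\<not> (swap_tops P \<and> lead_to_a P)" "\<not> (swap_tops ?P' \<and> lead_to_a ?P')"
          using lead oa by (auto simp: swap_tops_def)
        then show ?thesis using TTC by (auto simp: diverted_off[OF i])
      next
        case A: True
        have sw: "swap_tops P \<longleftrightarrow> rank 1 (P i) S = a" "swap_tops ?P' \<longleftrightarrow> rank 1 (?P' i) S = a"
          using A sep oa ib by (auto simp: swap_tops_def)
        have B: "TTC P i = rank 1 (P i) S" if "rank 1 (P i) S \<noteq> a"
          using TTC_owner_b_best[OF P sep(1)] A that ib by auto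
        have B': "TTC ?P' i = rank 1 (?P' i) S" if "rank 1 (?P' i) S \<noteq> a"
          using TTC_owner_b_best[OF P' sep(2)] A lead oa that ib by auto
        show ?thesis
        proof (cases "rank 1 (P i) S = a")
          case True
          then have "swap_tops P" using sw(1) by blast
          then have "diverted P i = second P"
            using A iS 2 ab by (simp add: diverted_on[OF i] reroute_eq)
          then have "diverted P i = rank 1 (P i) (S - {a})"
            by (simp only: second_def ib)
          \<comment> \<open>A report with \<open>a\<close> on top leads to the diversion, which
            withholds \<open>a\<close>; with any other report TTC gives the reported best object,
            again not \<open>a\<close>. Truth already yields the best object of
            \<open>S - {a}\<close>.\<close>
          moreover have "diverted ?P' i \<noteq> a"
          proof (cases "rank 1 (?P' i) S = a")
            case True
            then have sw': "swap_tops ?P'" using sw(2) by blast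
            then have "diverted ?P' i = second ?P'"
              using A lead iS 2 ab by (simp add: diverted_on[OF i] reroute_eq)
            then show ?thesis using second_in[OF P' sw'] by auto
          next
            case False
            then show ?thesis using B' sw(2) by (auto simp: diverted_off[OF i])
          qed
          ultimately show ?thesis using best[of "S - {a}"] inside by blast
        next
          case False
          then have "diverted P i = rank 1 (P i) S"
            using B sw(1) by (auto simp: diverted_off[OF i])
          then show ?thesis using best[OF _ inside subset_refl] by blast
        qed
      qed
    next
      case 3
      have oi: "owner a \<noteq> i" "owner b \<noteq> i" using eo 3 by auto
      have sw: "swap_tops ?P' \<longleftrightarrow> swap_tops P"
        using oi sep by (auto simp: swap_tops_def)
      show ?thesis
      proof (cases "swap_tops P")
        case False
        then show ?thesis using sw TTC by (auto simp: diverted_off[OF i])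
      next
        case True
        then have sw': "swap_tops ?P'" using sw by simp
        have sec: "second ?P' = second P" using oi by (simp add: second_def)
        show ?thesis
        proof (rule diverted_other_cases[OF P True i 3])
          assume "diverted P i = rank 1 (P i) (S - {b})"
          then show ?thesis
            using best diverted_other_not_b[OF P' sw' i 3] by blast
        next
          fix j assume "j \<in> N" "e j \<in> S - {a, b}" "j \<noteq> i" "rank 1 (P j) (S - {b}) = e j"
          then have "\<not> lead_to_a P" "\<not> lead_to_a ?P'"
            unfolding lead_to_a_def by (metis fun_upd_other)+
          then show ?thesis using TTC by (auto simp: diverted_off[OF i])
        next
          assume s: "e i \<noteq> second P" and t: "third P = a"
          have "owner (second P) \<noteq> i"
            using s second_in[OF P True] S e_owner by auto
          then have "third ?P' = a" using t sec by (simp add: third_def)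
          then have "diverted ?P' i = e i" "diverted P i = e i"
            using diverted_other_own[OF P' sw' i 3] diverted_other_own[OF P True i 3 s t] s sec
            by simp_all
          then show ?thesis using prefs_irrefl[OF profile_prefs[OF P i]] by simp
        qed
      qed
    qed
  qed
qed

section \<open>The new rule and its departure from TTC\<close>

definition diverted_rule :: "('i \<Rightarrow> 'o rel) \<Rightarrow> 'i \<Rightarrow> 'o" where
  "diverted_rule = (\<lambda>P \<in> profiles N D. diverted P)"

lemma diverted_rule_axioms:
  "diverted_rule \<in> rules N Obj D" "individually_rational N e D diverted_rule"
  "pareto_efficient N Obj D diverted_rule" "strategyproof N D diverted_rule"
proof -
  show "diverted_rule \<in> rules N Obj D"
    using diverted_allocation by (simp add: rules_def diverted_rule_def)
  show "individually_rational N e D diverted_rule"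
    using diverted_rational by (simp add: individually_rational_def diverted_rule_def)
  show "pareto_efficient N Obj D diverted_rule"
    using diverted_efficient by (auto simp: pareto_efficient_def diverted_rule_def)
  show "strategyproof N D diverted_rule"
    using diverted_truthful profile_upd by (auto simp: strategyproof_def diverted_rule_def)
qed

lemma diverted_rule_neq_ttc:
  assumes top_a: "a \<in> tops D S" and top_b: "b \<in> tops D S"
    and outside: "\<And>c. c \<in> Obj - S \<Longrightarrow> c \<in> tops D (S \<union> {c})"
  shows "diverted_rule \<noteq> ttc_rule N e D"
proof
  assume eq: "diverted_rule = ttc_rule N e D"
  obtain Pa where Pa: "Pa \<in> D" "rank 1 Pa S = a" using top_a by (auto simp: tops_def)
  obtain Pb where Pb: "Pb \<in> D" "rank 1 Pb S = b" using top_b by (auto simp: tops_def)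
  have "\<exists>Q \<in> D. rank 1 Q (S \<union> {c}) = c" if "c \<in> Obj - S" for c
    using outside[OF that] unfolding tops_def by (rule imageE) (rule bexI, rule sym)
  then obtain Q where Q: "\<And>c. c \<in> Obj - S \<Longrightarrow> Q c \<in> D \<and> rank 1 (Q c) (S \<union> {c}) = c"
    by metis
  \<comment> \<open>A profile that triggers the diversion: outside agents put their own object above
    \<open>S\<close>, the owner of \<open>a\<close> wants \<open>b\<close>, and all others in
    \<open>S\<close>, including the owner of \<open>b\<close>, want \<open>a\<close>.\<close>
  define P where "P = (\<lambda>i \<in> N. if e i \<notin> S then Q (e i) else if e i = a then Pb else Pa)"
  have P: "P \<in> profiles N D"
    using Pa Pb Q e_in by (auto simp: profiles_def P_def)
  have oN: "owner a \<in> N" "owner b \<in> N" and eo: "e (owner a) = a" "e (owner b) = b"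
    using a b S owner_in e_owner by auto
  have sep: "separated P"
    unfolding separated_def
  proof (intro ballI impI)
    fix i c assume i: "i \<in> N" "e i \<notin> S" and c: "c \<in> S"
    have "P i = Q (e i)" using i by (simp add: P_def)
    then have "rank 1 (P i) (S \<union> {e i}) = e i" using Q e_in i by auto
    moreover have "S \<union> {e i} \<subseteq> Obj" "finite (S \<union> {e i})" using S fin_S e_in i by auto
    moreover have "c \<noteq> e i" using c i by auto
    ultimately have "(e i, c) \<in> P i"
      using rank_1_preferred[OF profile_prefs[OF P i(1)], of "S \<union> {e i}" c] c by auto
    then show "(TTC P i, c) \<in> P i"
      using TTC_rational[OF P i(1)] prefs_trans[OF profile_prefs[OF P i(1)]]
      unfolding weakly_pref_def by metis
  qed
  have sw: "swap_tops P"
    using sep oN eo a b ab Pa Pb by (simp add: swap_tops_def P_def)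
  note s = second_in[OF P sw]
  have "rank 1 Pa (S - {b}) = a"
  proof (rule rank_1_eqI)
    show "Pa \<in> prefs Obj" using Pa D by auto
    show "S - {b} \<subseteq> Obj" "finite (S - {b})" "a \<in> S - {b}" using S fin_S a ab by auto
    show "(c, a) \<notin> Pa" if "c \<in> S - {b}" for c
      using best_not_beaten[OF P oN(2) subset_refl, of c] that oN eo b ab Pa by (auto simp: P_def)
  qed
  then have best: "rank 1 (P i) (S - {b}) = a" if "i \<in> N" "e i \<in> S - {a, b}" for i
    using that by (simp add: P_def)
  moreover have "owner (second P) \<in> N" "e (owner (second P)) = second P"
    using s S owner_in e_owner by auto
  ultimately have "\<exists>i \<in> N. e i \<in> S - {a, b} \<and> rank 1 (P i) (S - {b}) = a"
    using s by (intro bexI[of _ "owner (second P)"] conjI) auto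
  then have lead: "lead_to_a P" using best unfolding lead_to_a_def by auto
  have "diverted P (owner b) = second P"
    using diverted_on[OF oN(2) sw lead] eo b ab by (simp add: reroute_eq)
  moreover have "TTC P (owner b) = a" by (rule swap_topsD(2)[OF P sw])
  moreover have "diverted P = TTC P"
    using fun_cong[OF eq, of P] P by (simp add: diverted_rule_def ttc_rule_def)
  ultimately show False using s by simp
qed

end

theorem theorem2:
  fixes n :: nat and N :: "nat set" and Obj :: "'o set" and e :: "nat \<Rightarrow> 'o"
    and D :: "'o rel set"
  assumes N: "N = {1..n}"
    and e: "bij_betw e N Obj"
    and D: "D \<subseteq> prefs Obj"
    and not_top_two: "\<not> top_two Obj D"
    and ex_S: "\<exists>S \<subseteq> Obj. \<not> top_two_within D S \<and> card S \<le> 4 \<and>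
      (\<forall>a \<in> Obj - S. a \<in> tops D (S \<union> {a}))"
  shows "\<exists>\<phi> \<in> rules N Obj D. \<phi> \<noteq> ttc_rule N e D \<and>
    individually_rational N e D \<phi> \<and> pareto_efficient N Obj D \<phi> \<and> strategyproof N D \<phi>"
proof -
  obtain S where S: "S \<subseteq> Obj" "\<not> top_two_within D S" "card S \<le> 4"
    and outside: "\<And>c. c \<in> Obj - S \<Longrightarrow> c \<in> tops D (S \<union> {c})"
    using ex_S by blast
  obtain a b where tops: "a \<in> tops D S" "b \<in> tops D S" and ab: "a \<noteq> b"
    and none: "\<And>P\<^sub>0. P\<^sub>0 \<in> D \<Longrightarrow> \<not> (a = rank 1 P\<^sub>0 S \<and> b = rank 2 P\<^sub>0 S)"
    using S(2) unfolding top_two_within_def by blast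
  have fin: "finite S" using S(1) N e by (metis bij_betw_finite finite_atLeastAtMost finite_subset)
  \<comment> \<open>On the empty set \<open>rank\<close> is the same unspecified value for every
    preference, so \<open>tops D {}\<close> could not contain two distinct objects.\<close>
  have "S \<noteq> {}"
    using tops ab by (auto simp: tops_def rank_def)
  then have in_S: "tops D S \<subseteq> S"
    using rank_1_in[of _ Obj S] S(1) fin D by (auto simp: tops_def)
  interpret market N Obj e D S a b
  proof
    show "rank 1 P\<^sub>0 (S - {a}) \<noteq> b" if "P\<^sub>0 \<in> D" "rank 1 P\<^sub>0 S = a" for P\<^sub>0
      using rank_2_eqI[of P\<^sub>0 Obj S a b] none[OF that(1)] that D S(1) fin ab tops in_S by auto
  qed (use N e D S ab tops in_S in auto)
  show ?thesis
    using diverted_rule_axioms diverted_rule_neq_ttc[OF tops outside] by blast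
qed

end
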